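(* Let $(x,s)\in\mathcal{C}$ be a feasible first-stage decision, let $\xi\in\mathbb{Z}_{\ge 0}^{|\mathcal{A}|}$ be a realization of demand, and let $\hat i\in\mathcal{I}$ be a given station. Consider the integer program $Q^{\hat i}(x,s,\xi)$: $$\max \sum_{j\in\mathcal{J}_{\hat i}}\sum_{l\in\mathcal{L}}P_{\hat ijl}r_{jl}\quad\text{s.t.}\quad r_{jl}\le \xi_{\hat ij}x_{\zeta(\hat i),\zeta(j),l}\ \ \forall j\in\mathcal{J}_{\hat i},\ l\in\mathcal{L};\qquad \sum_{(j,l)\in\mathcal{J}_{\hat i}\times\mathcal{L}}r_{jl}\le\sum_{v\in\mathcal{V}}s_{v\hat i};\qquad r_{jl}\in\mathbb{Z}_{\ge 0}\ \ \forall j\in\mathcal{J}_{\hat i},\ l\in\mathcal{L}.$$ (1) If the vehicle supply is at least the total demand, that is, $\sum_{v\in\mathcal{V}}s_{v\hat i}\ge\sum_{(j,l)\in\mathcal{J}_{\hat i}\times\mathcal{L}}\xi_{\hat ij}x_{\zeta(\hat i),\zeta(j),l}$, then the optimal solution is $\hat r_{jl}=\xi_{\hat ij}x_{\zeta(\hat i),\zeta(j),l}$ for all $(j,l)\in\mathcal{J}_{\hat i}\times\mathcal{L}$. (2) Otherwise, assume $\sum_{v\in\mathcal{V}}s_{v\hat i}<\sum_{(j,l)\in\mathcal{J}_{\hat i}\times\mathcal{L}}\xi_{\hat ij}x_{\zeta(\hat i),\zeta(j),l}$. Let $\mathcal{K}=\{(j,l)\in\mathcal{J}_{\hat i}\times\mathcal{L}: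 x_{\zeta(\hat i),\zeta(j),l}=1\}$; observe that $|\mathcal{K}|=|\mathcal{J}_{\hat i}|$ as $x$ is a feasible pricing decision. Write $P_{jl}=P_{\hat ijl}$ and sort the values $P_{jl}$ for the indices $(j,l)\in\mathcal{K}$ such that, for $k=2,\ldots,|\mathcal{J}_{\hat i}|-1$, $$P_{(j,l)^{(k-1)}}\ge P_{(j,l)^{(k)}}\ge P_{(j,l)^{(k+1)}},$$ where $(j,l)^{(k)}=(j^{(k)},l^{(k)})$ denotes the $k$-th pair in this order. Identify the index $2\le\hat k\le|\mathcal{J}_{\hat i}|$ such that $$\sum_{k=1}^{\hat k-1}\xi_{\hat i,j^{(k)}}\le\sum_{v\in\mathcal{V}}s_{v\hat i}\quad\text{and}\quad\sum_{k=1}^{\hat k}\xi_{\hat i,j^{(k)}}>\sum_{v\in\mathcal{V}}s_{v\hat i}.$$ Then the optimal solution is $$\hat r_{jl}=\begin{cases}\xi_{\hat i,j} & \forall (j,l)\in\{(j,l)^{(1)},(j,l)^{(2)},\ldots,(j,l)^{(\hat k-1)}\},\\ \sum_{v\in\mathcal{V}}s_{v\hat i}-\sum_{k=1}^{\hat k-1}\xi_{\hat i,j^{(k)}} & (j,l)=(j,l)^{(\hat k)},\\ 0 & \forall (j,l)\in(\mathcal{J}_{\hat i}\times\mathcal{L})\setminus\{(j,l)^{(1)},(j,l)^{(2)},\ldots,(j,l)^{(\hat k)}\}.\end{cases}$$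
   Context: $\mathcal{I}$ (stations), $\mathcal{Z}$ (zones), $\mathcal{L}$ (price levels), $\mathcal{V}$ (vehicles) are finite sets. $\mathcal{A}=\{(i,j): i,j\in\mathcal{I},\ i\ne j\}$. The stations are partitioned into zones, and $\zeta:\mathcal{I}\to\mathcal{Z}$ maps a station to its zone. $\mathcal{J}_i=\{j\in\mathcal{I}:(i,j)\in\mathcal{A}\}$. $P_{ijl}$ is the rental price from station $i$ to station $j$ at price level $l$. $\xi_{ij}$ is the demand on arc $(i,j)$. $\mathcal{C}$ is the set of pairs $(x,s)$ with $x=(x_{z_1,z_2,l})\in\{0,1\}^{|\mathcal{Z}|\times|\mathcal{Z}|\times|\mathcal{L}|}$ and $s=(s_{vi})\in\{0,1\}^{|\mathcal{V}|\times|\mathcal{I}|}$ such that $\sum_{l\in\mathcal{L}}x_{z_1,z_2,l}=1$ for all $z_1,z_2\in\mathcal{Z}$ and $\sum_{i\in\mathcal{I}}s_{vi}=1$ for all $v\in\mathcal{V}$.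
   Formalization: Prices are assumed nonnegative (a negative price breaks (1)); the index k̂ is shown to exist, uniquely, only if the first demand is at most the supply (otherwise none exists in 2..|J|); all adjacent prices are compared, also for |J|=2; "the optimal solution" means an optimal one. *)

theory Defs
  imports Complex_Main
begin

text \<open>
  Stations, zones, price levels and vehicles are finite carrier sets. Families indexed by them
  are total functions of which only the values on the carriers matter. Integral data
  (decisions, demands, rentals) have type \<^typ>\<open>int\<close>, with nonnegativity stated explicitly.
\<close>

definition arcs :: "'i set \<Rightarrow> ('i \<times> 'i) set" where
  "arcs I = {(i, j). i \<in> I \<and> j \<in> I \<and> i \<noteq> j}"

definition destinations :: "'i set \<Rightarrow> 'i \<Rightarrow> 'i set" where
  "destinations I i = {j \<in> I. (i, j) \<in> arcs I}"

definition first_stage ::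
  "'i set \<Rightarrow> 'z set \<Rightarrow> 'l set \<Rightarrow> 'v set \<Rightarrow> (('z \<Rightarrow> 'z \<Rightarrow> 'l \<Rightarrow> int) \<times> ('v \<Rightarrow> 'i \<Rightarrow> int)) set" where
  "first_stage I Z L V = {(x, s).
     (\<forall>z1\<in>Z. \<forall>z2\<in>Z. \<forall>l\<in>L. x z1 z2 l \<in> {0, 1}) \<and>
     (\<forall>v\<in>V. \<forall>i\<in>I. s v i \<in> {0, 1}) \<and>
     (\<forall>z1\<in>Z. \<forall>z2\<in>Z. (\<Sum>l\<in>L. x z1 z2 l) = 1) \<and>
     (\<forall>v\<in>V. (\<Sum>i\<in>I. s v i) = 1)}"

definition vehicle_supply :: "'v set \<Rightarrow> ('v \<Rightarrow> 'i \<Rightarrow> int) \<Rightarrow> 'i \<Rightarrow> int" where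
  "vehicle_supply V s i = (\<Sum>v\<in>V. s v i)"

definition total_demand ::
  "'i set \<Rightarrow> 'l set \<Rightarrow> ('i \<Rightarrow> 'z) \<Rightarrow> ('z \<Rightarrow> 'z \<Rightarrow> 'l \<Rightarrow> int) \<Rightarrow> ('i \<Rightarrow> 'i \<Rightarrow> int) \<Rightarrow> 'i \<Rightarrow> int" where
  "total_demand I L \<zeta> x \<xi> i =
     (\<Sum>(j, l) \<in> destinations I i \<times> L. \<xi> i j * x (\<zeta> i) (\<zeta> j) l)"

definition feasible_rentals ::
  "'i set \<Rightarrow> 'l set \<Rightarrow> 'v set \<Rightarrow> ('i \<Rightarrow> 'z) \<Rightarrow> ('z \<Rightarrow> 'z \<Rightarrow> 'l \<Rightarrow> int) \<Rightarrow> ('v \<Rightarrow> 'i \<Rightarrow> int) \<Rightarrow>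
   ('i \<Rightarrow> 'i \<Rightarrow> int) \<Rightarrow> 'i \<Rightarrow> ('i \<Rightarrow> 'l \<Rightarrow> int) set" where
  "feasible_rentals I L V \<zeta> x s \<xi> i = {r.
     (\<forall>j\<in>destinations I i. \<forall>l\<in>L. r j l \<le> \<xi> i j * x (\<zeta> i) (\<zeta> j) l) \<and>
     (\<Sum>(j, l) \<in> destinations I i \<times> L. r j l) \<le> vehicle_supply V s i \<and>
     (\<forall>j\<in>destinations I i. \<forall>l\<in>L. 0 \<le> r j l)}"

definition revenue ::
  "'i set \<Rightarrow> 'l set \<Rightarrow> ('i \<Rightarrow> 'i \<Rightarrow> 'l \<Rightarrow> real) \<Rightarrow> 'i \<Rightarrow> ('i \<Rightarrow> 'l \<Rightarrow> int) \<Rightarrow> real" where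
  "revenue I L P i r = (\<Sum>j\<in>destinations I i. \<Sum>l\<in>L. P i j l * real_of_int (r j l))"

text \<open>
  Optimal solutions of the integer program. The maximiser need not be unique (prices may tie
  or vanish), so optimality is a predicate on solutions.
\<close>

definition optimal_rentals ::
  "'i set \<Rightarrow> 'l set \<Rightarrow> 'v set \<Rightarrow> ('i \<Rightarrow> 'z) \<Rightarrow> ('i \<Rightarrow> 'i \<Rightarrow> 'l \<Rightarrow> real) \<Rightarrow>
   ('z \<Rightarrow> 'z \<Rightarrow> 'l \<Rightarrow> int) \<Rightarrow> ('v \<Rightarrow> 'i \<Rightarrow> int) \<Rightarrow> ('i \<Rightarrow> 'i \<Rightarrow> int) \<Rightarrow> 'i \<Rightarrow>
   ('i \<Rightarrow> 'l \<Rightarrow> int) \<Rightarrow> bool" where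
  "optimal_rentals I L V \<zeta> P x s \<xi> i r \<longleftrightarrow>
     is_arg_max (revenue I L P i) (\<lambda>r. r \<in> feasible_rentals I L V \<zeta> x s \<xi> i) r"

definition offered_pairs ::
  "'i set \<Rightarrow> 'l set \<Rightarrow> ('i \<Rightarrow> 'z) \<Rightarrow> ('z \<Rightarrow> 'z \<Rightarrow> 'l \<Rightarrow> int) \<Rightarrow> 'i \<Rightarrow> ('i \<times> 'l) set" where
  "offered_pairs I L \<zeta> x i = {(j, l) \<in> destinations I i \<times> L. x (\<zeta> i) (\<zeta> j) l = 1}"

text \<open>
  \<open>\<sigma>\<close> enumerates \<open>K\<close> by the positions \<open>1, \<dots>, n\<close> in order of nonincreasing price. The adjacent
  comparisons range over \<open>1 \<le> k < n\<close>, so that the case \<open>n = 2\<close> is sorted as well.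
\<close>

definition price_sorting ::
  "('i \<Rightarrow> 'i \<Rightarrow> 'l \<Rightarrow> real) \<Rightarrow> 'i \<Rightarrow> ('i \<times> 'l) set \<Rightarrow> nat \<Rightarrow> (nat \<Rightarrow> 'i \<times> 'l) \<Rightarrow> bool" where
  "price_sorting P i K n \<sigma> \<longleftrightarrow>
     bij_betw \<sigma> {1..n} K \<and>
     (\<forall>k\<in>{1..<n}. P i (fst (\<sigma> k)) (snd (\<sigma> k)) \<ge> P i (fst (\<sigma> (k + 1))) (snd (\<sigma> (k + 1))))"

definition cumulative_demand ::
  "('i \<Rightarrow> 'i \<Rightarrow> int) \<Rightarrow> 'i \<Rightarrow> (nat \<Rightarrow> 'i \<times> 'l) \<Rightarrow> nat \<Rightarrow> int" where
  "cumulative_demand \<xi> i \<sigma> m = (\<Sum>k=1..m. \<xi> i (fst (\<sigma> k)))"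

definition critical_index ::
  "('i \<Rightarrow> 'i \<Rightarrow> int) \<Rightarrow> 'i \<Rightarrow> (nat \<Rightarrow> 'i \<times> 'l) \<Rightarrow> nat \<Rightarrow> int \<Rightarrow> nat \<Rightarrow> bool" where
  "critical_index \<xi> i \<sigma> n S k \<longleftrightarrow>
     2 \<le> k \<and> k \<le> n \<and>
     cumulative_demand \<xi> i \<sigma> (k - 1) \<le> S \<and> cumulative_demand \<xi> i \<sigma> k > S"

definition greedy_rentals ::
  "('i \<Rightarrow> 'i \<Rightarrow> int) \<Rightarrow> 'i \<Rightarrow> (nat \<Rightarrow> 'i \<times> 'l) \<Rightarrow> int \<Rightarrow> nat \<Rightarrow> 'i \<Rightarrow> 'l \<Rightarrow> int" where
  "greedy_rentals \<xi> i \<sigma> S k j l =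
     (if (j, l) \<in> \<sigma> ` {1..k - 1} then \<xi> i j
      else if (j, l) = \<sigma> k then S - cumulative_demand \<xi> i \<sigma> (k - 1)
      else 0)"

end

theory Submission
  imports Defs
begin

text \<open>
  The program is a knapsack with unit weights: every rental uses one vehicle, and pair \<open>(j, l)\<close>
  has the upper bound \<open>\<xi> i j * x (\<zeta> i) (\<zeta> j) l\<close>. Optimality of both proposed solutions is
  certified by linear programming duality, in the form of complementary slackness with a single
  multiplier \<open>\<mu> \<ge> 0\<close>, the value of one more vehicle
  (\<open>optimal_rentals_if_complementary_slackness\<close>): a feasible plan is optimal if pairs dearer
  than \<open>\<mu>\<close> are at their bound, pairs cheaper than \<open>\<mu>\<close> are not served, and \<open>\<mu> > 0\<close> only when the
  supply is used up. The certificate bounds the linear relaxation, hence also the integer program.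

  If supply covers demand, then \<open>\<mu> = 0\<close> works, since prices are nonnegative. Otherwise \<open>\<mu>\<close> is the
  price of the pair at the critical position: the sorting puts all dearer pairs before it, where
  the greedy plan is at the bound, and all cheaper ones after it, where the plan is zero; the
  critical pair itself takes exactly the remaining vehicles
  (\<open>optimal_rentals_greedy_rentals\<close>). Pairs that are not offered have bound zero, so that their
  value zero is allowed at every price.

  A critical position exists and is unique because the cumulative demands are nondecreasing and
  end at the total demand, which exceeds the supply
  (\<open>ex1_threshold_crossing\<close>, \<open>total_demand_eq_cumulative_demand\<close>).
\<close>

section \<open>An optimality certificate\<close>

lemma finite_destinations: "finite I \<Longrightarrow> finite (destinations I i)"
  unfolding destinations_def by simp

text \<open>
  For a feasible \<open>r\<close>, every term of \<open>\<Sum>(P - \<mu>) * (r - q)\<close> is at most zero by the conditions on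
  dear and cheap pairs, and \<open>\<mu> * \<Sum>(r - q)\<close> is at most zero by the condition on the supply. The
  two add up to the difference of the revenues.
\<close>

lemma optimal_rentals_if_complementary_slackness:
  fixes P :: "'i \<Rightarrow> 'i \<Rightarrow> 'l \<Rightarrow> real" and \<mu> :: real
  assumes feas: "q \<in> feasible_rentals I L V \<zeta> x s \<xi> i"
    and nonneg: "0 \<le> \<mu>"
    and exhausted: "0 < \<mu> \<Longrightarrow> (\<Sum>(j, l) \<in> destinations I i \<times> L. q j l) = vehicle_supply V s i"
    and dear: "\<And>j l. j \<in> destinations I i \<Longrightarrow> l \<in> L \<Longrightarrow> \<mu> < P i j l \<Longrightarrow>
      q j l = \<xi> i j * x (\<zeta> i) (\<zeta> j) l"
    and cheap: "\<And>j l. j \<in> destinations I i \<Longrightarrow> l \<in> L \<Longrightarrow> P i j l < \<mu> \<Longrightarrow> q j l = 0"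
  shows "optimal_rentals I L V \<zeta> P x s \<xi> i q"
proof -
  let ?A = "destinations I i \<times> L"
  have "revenue I L P i r \<le> revenue I L P i q"
    if r: "r \<in> feasible_rentals I L V \<zeta> x s \<xi> i" for r
  proof -
    have termwise: "(P i j l - \<mu>) * real_of_int (r j l - q j l) \<le> 0"
      if "j \<in> destinations I i" "l \<in> L" for j l
    proof (cases "P i j l" \<mu> rule: linorder_cases)
      case less
      then have "q j l = 0" "0 \<le> r j l"
        using cheap that r unfolding feasible_rentals_def by auto
      with less show ?thesis by (simp add: mult_nonpos_nonneg)
    next
      case equal
      then show ?thesis by simp
    next
      case greater
      then have "r j l \<le> q j l"
        using dear that r unfolding feasible_rentals_def by auto
      with greater show ?thesis by (simp add: mult_nonneg_nonpos)
    qed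
    have total: "\<mu> * real_of_int (\<Sum>(j, l)\<in>?A. r j l - q j l) \<le> 0"
    proof (cases "0 < \<mu>")
      case True
      then have "(\<Sum>(j, l)\<in>?A. r j l) \<le> (\<Sum>(j, l)\<in>?A. q j l)"
        using exhausted r unfolding feasible_rentals_def by simp
      then have "(\<Sum>(j, l)\<in>?A. r j l - q j l) \<le> 0"
        by (simp add: case_prod_unfold sum_subtractf)
      then have "real_of_int (\<Sum>(j, l)\<in>?A. r j l - q j l) \<le> 0"
        by (simp only: of_int_le_0_iff)
      then show ?thesis
        using nonneg by (rule mult_nonneg_nonpos[rotated])
    next
      case False
      with nonneg show ?thesis by simp
    qed
    have "revenue I L P i r - revenue I L P i q =
        (\<Sum>(j, l)\<in>?A. P i j l * real_of_int (r j l - q j l))"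
      unfolding revenue_def
      by (simp add: sum.cartesian_product case_prod_unfold sum_subtractf right_diff_distrib)
    also have "\<dots> = (\<Sum>(j, l)\<in>?A. (P i j l - \<mu>) * real_of_int (r j l - q j l)) +
        \<mu> * real_of_int (\<Sum>(j, l)\<in>?A. r j l - q j l)"
      by (simp add: of_int_sum sum_distrib_left case_prod_unfold algebra_simps
          flip: sum.distrib)
    also have "\<dots> \<le> 0"
    proof -
      have "(\<Sum>(j, l)\<in>?A. (P i j l - \<mu>) * real_of_int (r j l - q j l)) \<le> 0"
        by (rule sum_nonpos) (use termwise in auto)
      with total show ?thesis by linarith
    qed
    finally show ?thesis by simp
  qed
  with feas show ?thesis
    unfolding optimal_rentals_def is_arg_max_def by (auto simp: not_less)
qed

section \<open>Offered pairs\<close>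

text \<open>
  Feasible pricing decisions are indicators, so any weighting by \<open>x\<close> can be read as a sum over
  the offered pairs. Weight one counts these pairs, and weight \<open>\<xi>\<close> gives the total demand.
\<close>

lemma sum_price_indicator_eq_sum_offered_pairs:
  fixes f :: "'i \<Rightarrow> 'l \<Rightarrow> int"
  assumes fin: "finite I" "finite L"
    and binary: "\<And>j l. j \<in> destinations I i \<Longrightarrow> l \<in> L \<Longrightarrow> x (\<zeta> i) (\<zeta> j) l \<in> {0, 1}"
  shows "(\<Sum>(j, l) \<in> destinations I i \<times> L. f j l * x (\<zeta> i) (\<zeta> j) l) =
    (\<Sum>(j, l) \<in> offered_pairs I L \<zeta> x i. f j l)"
proof -
  have "(\<Sum>(j, l) \<in> destinations I i \<times> L. f j l * x (\<zeta> i) (\<zeta> j) l) =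
      (\<Sum>(j, l) \<in> offered_pairs I L \<zeta> x i. f j l * x (\<zeta> i) (\<zeta> j) l)"
    by (rule sum.mono_neutral_right)
      (use fin in \<open>auto simp: offered_pairs_def finite_destinations dest: binary\<close>)
  also have "\<dots> = (\<Sum>(j, l) \<in> offered_pairs I L \<zeta> x i. f j l)"
    by (rule sum.cong) (auto simp: offered_pairs_def)
  finally show ?thesis .
qed

text \<open>Each destination is offered at exactly one price level.\<close>

lemma card_offered_pairs:
  assumes fin: "finite I" "finite L"
    and binary: "\<And>j l. j \<in> destinations I i \<Longrightarrow> l \<in> L \<Longrightarrow> x (\<zeta> i) (\<zeta> j) l \<in> {0, 1}"
    and one_level: "\<And>j. j \<in> destinations I i \<Longrightarrow> (\<Sum>l\<in>L. x (\<zeta> i) (\<zeta> j) l) = 1"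
  shows "card (offered_pairs I L \<zeta> x i) = card (destinations I i)"
proof -
  have "int (card (offered_pairs I L \<zeta> x i)) =
      (\<Sum>(j, l) \<in> destinations I i \<times> L. 1 * x (\<zeta> i) (\<zeta> j) l)"
    by (subst sum_price_indicator_eq_sum_offered_pairs[where x = x and \<zeta> = \<zeta>])
      (use fin binary in auto)
  also have "\<dots> = (\<Sum>j\<in>destinations I i. \<Sum>l\<in>L. x (\<zeta> i) (\<zeta> j) l)"
    by (simp add: sum.cartesian_product)
  also have "\<dots> = int (card (destinations I i))"
    using one_level by simp
  finally show ?thesis by simp
qed

lemma total_demand_eq_cumulative_demand:
  assumes fin: "finite I" "finite L"
    and binary: "\<And>j l. j \<in> destinations I i \<Longrightarrow> l \<in> L \<Longrightarrow> x (\<zeta> i) (\<zeta> j) l \<in> {0, 1}"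
    and bij: "bij_betw \<sigma> {1..n} (offered_pairs I L \<zeta> x i)"
  shows "total_demand I L \<zeta> x \<xi> i = cumulative_demand \<xi> i \<sigma> n"
proof -
  have "total_demand I L \<zeta> x \<xi> i = (\<Sum>p \<in> offered_pairs I L \<zeta> x i. \<xi> i (fst p))"
    unfolding total_demand_def
    by (subst sum_price_indicator_eq_sum_offered_pairs[where x = x and \<zeta> = \<zeta>])
      (use fin binary in \<open>auto simp: case_prod_unfold\<close>)
  also have "\<dots> = cumulative_demand \<xi> i \<sigma> n"
    unfolding cumulative_demand_def
    using sum.reindex_bij_betw[OF bij, of "\<lambda>p. \<xi> i (fst p)"] by simp
  finally show ?thesis .
qed

section \<open>The critical position\<close>

lemma cumulative_demand_mono:
  assumes "\<And>m. m \<in> {1..n} \<Longrightarrow> 0 \<le> \<xi> i (fst (\<sigma> m))" and "a \<le> b" and "b \<le> n"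
  shows "cumulative_demand \<xi> i \<sigma> a \<le> cumulative_demand \<xi> i \<sigma> b"
  unfolding cumulative_demand_def by (rule sum_mono2) (use assms in auto)

lemma ex1_threshold_crossing:
  fixes f :: "nat \<Rightarrow> 'a::linorder"
  assumes mono: "\<And>a b. a \<le> b \<Longrightarrow> b \<le> n \<Longrightarrow> f a \<le> f b"
    and start: "f 1 \<le> S" and finish: "S < f n" and "1 \<le> n"
  shows "\<exists>!k. 2 \<le> k \<and> k \<le> n \<and> f (k - 1) \<le> S \<and> S < f k"
proof (rule ex_ex1I)
  define k where "k = (LEAST k. 1 \<le> k \<and> S < f k)"
  have k: "1 \<le> k" "S < f k"
    using LeastI[of "\<lambda>k. 1 \<le> k \<and> S < f k" n] finish \<open>1 \<le> n\<close> unfolding k_def by auto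
  have "k \<le> n"
    unfolding k_def by (rule Least_le) (use finish \<open>1 \<le> n\<close> in auto)
  moreover have "2 \<le> k"
    using k start by (cases "k = 1") auto
  moreover have "f (k - 1) \<le> S"
    using not_less_Least[of "k - 1" "\<lambda>k. 1 \<le> k \<and> S < f k"] \<open>2 \<le> k\<close>
    unfolding k_def[symmetric] by (auto simp: not_less)
  ultimately show "\<exists>k. 2 \<le> k \<and> k \<le> n \<and> f (k - 1) \<le> S \<and> S < f k"
    using k by blast
next
  fix a b
  assume a: "2 \<le> a \<and> a \<le> n \<and> f (a - 1) \<le> S \<and> S < f a"
    and b: "2 \<le> b \<and> b \<le> n \<and> f (b - 1) \<le> S \<and> S < f b"
  have "\<not> c < d" if "S < f c" "f (d - 1) \<le> S" "d \<le> n" for c d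
    using mono[of c "d - 1"] that by (cases d) auto
  from this[of a b] this[of b a] show "a = b"
    using a b by simp
qed

lemma price_sorting_antimono:
  assumes "price_sorting P i K n \<sigma>" and "1 \<le> a" and "a \<le> b" and "b \<le> n"
  shows "P i (fst (\<sigma> b)) (snd (\<sigma> b)) \<le> P i (fst (\<sigma> a)) (snd (\<sigma> a))"
  using assms(3,4)
proof (induction b rule: dec_induct)
  case base
  then show ?case by simp
next
  case (step m)
  then have "P i (fst (\<sigma> (Suc m))) (snd (\<sigma> (Suc m))) \<le> P i (fst (\<sigma> m)) (snd (\<sigma> m))"
    using assms(1,2) unfolding price_sorting_def by auto
  with step show ?case by simp
qed

section \<open>The greedy plan\<close>

text \<open>
  The description of the plan by pairs turns into one by positions because the enumeration has no
  repetitions.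
\<close>

lemma greedy_rentals_at_position:
  assumes "inj_on \<sigma> {1..n}" and "m \<in> {1..n}" and "k \<in> {1..n}"
  shows "greedy_rentals \<xi> i \<sigma> S k (fst (\<sigma> m)) (snd (\<sigma> m)) =
    (if m < k then \<xi> i (fst (\<sigma> m))
     else if m = k then S - cumulative_demand \<xi> i \<sigma> (k - 1) else 0)"
proof -
  have "\<sigma> m \<in> \<sigma> ` {1..k - 1} \<longleftrightarrow> m < k"
    using assms by (subst inj_on_image_mem_iff[OF assms(1)]) auto
  moreover have "\<sigma> m = \<sigma> k \<longleftrightarrow> m = k"
    using assms by (auto dest: inj_onD)
  ultimately show ?thesis
    unfolding greedy_rentals_def by simp
qed

lemma optimal_rentals_greedy_rentals:
  fixes P :: "'i \<Rightarrow> 'i \<Rightarrow> 'l \<Rightarrow> real"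
  assumes fin: "finite I" "finite L"
    and binary: "\<And>j l. j \<in> destinations I i \<Longrightarrow> l \<in> L \<Longrightarrow> x (\<zeta> i) (\<zeta> j) l \<in> {0, 1}"
    and price: "\<And>j l. j \<in> destinations I i \<Longrightarrow> l \<in> L \<Longrightarrow> 0 \<le> P i j l"
    and demand: "\<And>j. j \<in> destinations I i \<Longrightarrow> 0 \<le> \<xi> i j"
    and sorting: "price_sorting P i (offered_pairs I L \<zeta> x i) n \<sigma>"
    and critical: "critical_index \<xi> i \<sigma> n (vehicle_supply V s i) k"
  shows "optimal_rentals I L V \<zeta> P x s \<xi> i (greedy_rentals \<xi> i \<sigma> (vehicle_supply V s i) k)"
proof -
  let ?D = "destinations I i" and ?K = "offered_pairs I L \<zeta> x i"
  define S where "S = vehicle_supply V s i"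
  define q where "q = greedy_rentals \<xi> i \<sigma> S k"
  let ?c = "cumulative_demand \<xi> i \<sigma>"
  have bij: "bij_betw \<sigma> {1..n} ?K"
    using sorting unfolding price_sorting_def by simp
  have k: "2 \<le> k" "k \<le> n" "?c (k - 1) \<le> S" "S < ?c k"
    using critical unfolding critical_index_def S_def by auto
  have k_in: "k \<in> {1..n}" using k by simp
  have offered: "fst (\<sigma> m) \<in> ?D" "snd (\<sigma> m) \<in> L" "x (\<zeta> i) (\<zeta> (fst (\<sigma> m))) (snd (\<sigma> m)) = 1"
    if "m \<in> {1..n}" for m
    using bij_betwE[OF bij] that unfolding offered_pairs_def by (auto simp: case_prod_unfold)
  have q_pos: "q (fst (\<sigma> m)) (snd (\<sigma> m)) =
      (if m < k then \<xi> i (fst (\<sigma> m)) else if m = k then S - ?c (k - 1) else 0)"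
    if "m \<in> {1..n}" for m
    unfolding q_def by (rule greedy_rentals_at_position[OF bij_betw_imp_inj_on[OF bij] that k_in])
  have q_outside: "q j l = 0" if "(j, l) \<notin> ?K" for j l
  proof -
    have "(j, l) \<notin> \<sigma> ` {1..n}"
      using that bij_betw_imp_surj_on[OF bij] by simp
    then show ?thesis
      using k unfolding q_def greedy_rentals_def by force
  qed
  have c_step: "?c k = ?c (k - 1) + \<xi> i (fst (\<sigma> k))"
    using k unfolding cumulative_demand_def by (cases k) auto
  \<comment> \<open>Every pair is either not offered or at some position; this transfers claims to positions.\<close>
  have by_position: "Q j l"
    if "j \<in> ?D" "l \<in> L" and "\<And>m. m \<in> {1..n} \<Longrightarrow> Q (fst (\<sigma> m)) (snd (\<sigma> m))"
      and "(j, l) \<notin> ?K \<Longrightarrow> x (\<zeta> i) (\<zeta> j) l = 0 \<Longrightarrow> q j l = 0 \<Longrightarrow> Q j l" for Q j l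
  proof (cases "(j, l) \<in> ?K")
    case True
    then obtain m where "m \<in> {1..n}" "\<sigma> m = (j, l)"
      using bij_betw_imp_surj_on[OF bij] by (metis imageE)
    with that(3)[of m] show ?thesis by simp
  next
    case False
    moreover have "x (\<zeta> i) (\<zeta> j) l = 0"
      using False binary[OF that(1,2)] that(1,2) unfolding offered_pairs_def by auto
    ultimately show ?thesis
      using that(4) q_outside by simp
  qed
  have sum_q: "(\<Sum>(j, l) \<in> ?D \<times> L. q j l) = S"
  proof -
    have "(\<Sum>(j, l) \<in> ?D \<times> L. q j l) = (\<Sum>(j, l) \<in> ?K. q j l)"
      by (rule sum.mono_neutral_right)
        (use fin q_outside in \<open>auto simp: offered_pairs_def finite_destinations\<close>)
    also have "\<dots> = (\<Sum>m=1..n. q (fst (\<sigma> m)) (snd (\<sigma> m)))"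
      using sum.reindex_bij_betw[OF bij, of "\<lambda>(j, l). q j l"] by (simp add: case_prod_unfold)
    also have "\<dots> = (\<Sum>m=1..k. q (fst (\<sigma> m)) (snd (\<sigma> m)))"
      by (rule sum.mono_neutral_right) (use k q_pos in auto)
    also have "\<dots> = (\<Sum>m=1..k - 1. q (fst (\<sigma> m)) (snd (\<sigma> m))) + q (fst (\<sigma> k)) (snd (\<sigma> k))"
      using k by (cases k) auto
    also have "(\<Sum>m=1..k - 1. q (fst (\<sigma> m)) (snd (\<sigma> m))) = ?c (k - 1)"
      unfolding cumulative_demand_def by (rule sum.cong) (use k q_pos in auto)
    also have "q (fst (\<sigma> k)) (snd (\<sigma> k)) = S - ?c (k - 1)"
      using q_pos[OF k_in] by simp
    finally show ?thesis by simp
  qed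
  have upper: "q j l \<le> \<xi> i j * x (\<zeta> i) (\<zeta> j) l" if "j \<in> ?D" "l \<in> L" for j l
    using that by (rule by_position) (use k c_step q_pos offered demand in auto)
  have lower: "0 \<le> q j l" if "j \<in> ?D" "l \<in> L" for j l
    using that by (rule by_position) (use k q_pos offered demand in auto)
  define \<mu> where "\<mu> = P i (fst (\<sigma> k)) (snd (\<sigma> k))"
  have before: "m < k" if "m \<in> {1..n}" "\<mu> < P i (fst (\<sigma> m)) (snd (\<sigma> m))" for m
    using price_sorting_antimono[OF sorting, of k m] that k unfolding \<mu>_def by force
  have after: "k < m" if "m \<in> {1..n}" "P i (fst (\<sigma> m)) (snd (\<sigma> m)) < \<mu>" for m
    using price_sorting_antimono[OF sorting, of m k] that k unfolding \<mu>_def by force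
  have dear: "\<mu> < P i j l \<longrightarrow> q j l = \<xi> i j * x (\<zeta> i) (\<zeta> j) l" if "j \<in> ?D" "l \<in> L" for j l
    using that by (rule by_position) (use before q_pos offered in auto)
  have cheap: "P i j l < \<mu> \<longrightarrow> q j l = 0" if "j \<in> ?D" "l \<in> L" for j l
    using that by (rule by_position) (use after q_pos in fastforce)+
  have "optimal_rentals I L V \<zeta> P x s \<xi> i q"
  proof (rule optimal_rentals_if_complementary_slackness)
    show "q \<in> feasible_rentals I L V \<zeta> x s \<xi> i"
      using upper lower sum_q unfolding feasible_rentals_def S_def by simp
    show "0 \<le> \<mu>"
      unfolding \<mu>_def using price offered[OF k_in] by simp
    show "(\<Sum>(j, l) \<in> ?D \<times> L. q j l) = vehicle_supply V s i"
      using sum_q unfolding S_def .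
  qed (use dear cheap in auto)
  then show ?thesis unfolding q_def S_def .
qed

section \<open>Optimal rentals at a single station\<close>

theorem proposition3p2:
  fixes I :: "'i set" and Z :: "'z set" and L :: "'l set" and V :: "'v set"
    and \<zeta> :: "'i \<Rightarrow> 'z" and P :: "'i \<Rightarrow> 'i \<Rightarrow> 'l \<Rightarrow> real"
    and x :: "'z \<Rightarrow> 'z \<Rightarrow> 'l \<Rightarrow> int" and s :: "'v \<Rightarrow> 'i \<Rightarrow> int"
    and \<xi> :: "'i \<Rightarrow> 'i \<Rightarrow> int" and ihat :: 'i
  assumes "finite I" and "finite Z" and "finite L" and "finite V"
    and "\<And>i. i \<in> I \<Longrightarrow> \<zeta> i \<in> Z"
    and "\<And>i j l. (i, j) \<in> arcs I \<Longrightarrow> l \<in> L \<Longrightarrow> 0 \<le> P i j l"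
    and "(x, s) \<in> first_stage I Z L V"
    and "\<And>i j. (i, j) \<in> arcs I \<Longrightarrow> 0 \<le> \<xi> i j"
    and "ihat \<in> I"
  shows
    "(vehicle_supply V s ihat \<ge> total_demand I L \<zeta> x \<xi> ihat \<longrightarrow>
        optimal_rentals I L V \<zeta> P x s \<xi> ihat (\<lambda>j l. \<xi> ihat j * x (\<zeta> ihat) (\<zeta> j) l)) \<and>
     (vehicle_supply V s ihat < total_demand I L \<zeta> x \<xi> ihat \<longrightarrow>
        card (offered_pairs I L \<zeta> x ihat) = card (destinations I ihat) \<and>
        (\<forall>\<sigma>. price_sorting P ihat (offered_pairs I L \<zeta> x ihat) (card (destinations I ihat)) \<sigma> \<longrightarrow>
           (\<xi> ihat (fst (\<sigma> 1)) \<le> vehicle_supply V s ihat \<longrightarrow>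
              (\<exists>!k. critical_index \<xi> ihat \<sigma> (card (destinations I ihat)) (vehicle_supply V s ihat) k)) \<and>
           (\<forall>k. critical_index \<xi> ihat \<sigma> (card (destinations I ihat)) (vehicle_supply V s ihat) k \<longrightarrow>
              optimal_rentals I L V \<zeta> P x s \<xi> ihat
                (greedy_rentals \<xi> ihat \<sigma> (vehicle_supply V s ihat) k))))"
proof -
  let ?D = "destinations I ihat" and ?S = "vehicle_supply V s ihat"
  let ?K = "offered_pairs I L \<zeta> x ihat"
  have arc: "(ihat, j) \<in> arcs I" "j \<in> I" if "j \<in> ?D" for j
    using that unfolding destinations_def by auto
  have binary: "x (\<zeta> ihat) (\<zeta> j) l \<in> {0, 1}" if "j \<in> ?D" "l \<in> L" for j l
    using assms(5,7,9) arc that unfolding first_stage_def by blast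
  have one_level: "(\<Sum>l\<in>L. x (\<zeta> ihat) (\<zeta> j) l) = 1" if "j \<in> ?D" for j
    using assms(5,7,9) arc that unfolding first_stage_def by blast
  have price: "0 \<le> P ihat j l" if "j \<in> ?D" "l \<in> L" for j l
    using assms(6) arc that by blast
  have demand: "0 \<le> \<xi> ihat j" if "j \<in> ?D" for j
    using assms(8) arc that by blast
  have serve_all: "optimal_rentals I L V \<zeta> P x s \<xi> ihat (\<lambda>j l. \<xi> ihat j * x (\<zeta> ihat) (\<zeta> j) l)"
    if "total_demand I L \<zeta> x \<xi> ihat \<le> ?S"
  proof (rule optimal_rentals_if_complementary_slackness[where \<mu> = 0])
    have "0 \<le> \<xi> ihat j * x (\<zeta> ihat) (\<zeta> j) l" if "j \<in> ?D" "l \<in> L" for j l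
      using demand[OF that(1)] binary[OF that] by auto
    with that show "(\<lambda>j l. \<xi> ihat j * x (\<zeta> ihat) (\<zeta> j) l) \<in> feasible_rentals I L V \<zeta> x s \<xi> ihat"
      unfolding feasible_rentals_def total_demand_def by simp
  qed (use price in \<open>auto simp: not_less[symmetric]\<close>)
  have card: "card ?K = card ?D"
    using assms(1,3) binary one_level by (rule card_offered_pairs)
  have critical: "\<exists>!k. critical_index \<xi> ihat \<sigma> (card ?D) ?S k"
    if short: "?S < total_demand I L \<zeta> x \<xi> ihat"
      and sorting: "price_sorting P ihat ?K (card ?D) \<sigma>"
      and first: "\<xi> ihat (fst (\<sigma> 1)) \<le> ?S" for \<sigma>
  proof -
    have bij: "bij_betw \<sigma> {1..card ?D} ?K"
      using sorting unfolding price_sorting_def by simp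
    have nonneg: "0 \<le> \<xi> ihat (fst (\<sigma> m))" if "m \<in> {1..card ?D}" for m
      using bij_betwE[OF bij] that demand unfolding offered_pairs_def by (auto simp: case_prod_unfold)
    have finish: "?S < cumulative_demand \<xi> ihat \<sigma> (card ?D)"
      using short total_demand_eq_cumulative_demand[OF assms(1,3) _ bij] binary by auto
    have supply_nonneg: "0 \<le> ?S"
      unfolding vehicle_supply_def
      by (rule sum_nonneg) (use assms(7,9) in \<open>force simp: first_stage_def\<close>)
    \<comment> \<open>Without destinations the demand would be zero, which a nonnegative supply covers.\<close>
    have "1 \<le> card ?D"
      using finish supply_nonneg by (cases "card ?D") (auto simp: cumulative_demand_def)
    then show ?thesis
      unfolding critical_index_def
    proof (intro ex1_threshold_crossing)
      show "cumulative_demand \<xi> ihat \<sigma> a \<le> cumulative_demand \<xi> ihat \<sigma> b"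
        if "a \<le> b" "b \<le> card ?D" for a b
        using nonneg that by (rule cumulative_demand_mono)
    qed (use first finish in \<open>auto simp: cumulative_demand_def\<close>)
  qed
  have greedy: "optimal_rentals I L V \<zeta> P x s \<xi> ihat (greedy_rentals \<xi> ihat \<sigma> ?S k)"
    if "price_sorting P ihat ?K (card ?D) \<sigma>" and "critical_index \<xi> ihat \<sigma> (card ?D) ?S k" for \<sigma> k
    using assms(1,3) binary price demand that by (rule optimal_rentals_greedy_rentals)
  show ?thesis
    using serve_all card critical greedy by blast
qed

end
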